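(* Let $M\in\mathbb{R}^{n\times d}$ and $S\in\mathbb{B}^{n\times d}$. Then $S$ is satisfiable with respect to $M$ if and only if every partial bijection contained in $S$ is satisfiable with respect to $M$.
   Context: $\mathbb{B}^{n\times d}$ is the set of $n\times d$ Boolean matrices with entrywise order $\preceq$. For $a,y\in\mathbb{R}^n$, $\mathrm{Dom}_i(a)=\{y: y_i-a_i=\min_k(y_k-a_k)\}$. For $S\in\mathbb{B}^{n\times d}$, a point $x\in\mathbb{R}^n$ satisfies $S$ (with respect to $M$, with columns $M_{\star j}$) if $x\in\mathrm{Dom}_i(M_{\star j})$ for all $(i,j)$ with $S_{ij}=1$; $S$ is satisfiable if some point satisfies it. A partial bijection $\sigma:[d]\dashrightarrow[n]$ is a bijection $\sigma:J\to I$ with $J\subseteq[d]$, $I\subseteq[n]$, identified with $\Sigma\in\mathbb{B}^{n\times d}$, $\Sigma_{ij}=1$ iff $j\in J$ and $i=\sigma(j)$; $S$ contains $\sigma$ if $\Sigma\preceq S$, and $\sigma$ is satisfiable if $\Sigma$ is. *)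

theory Defs
  imports "HOL-Analysis.Analysis"
begin

definition Dom :: "'n::finite \<Rightarrow> real ^ 'n \<Rightarrow> (real ^ 'n) set" where
  "Dom i a = {y. y $ i - a $ i = (MIN k. y $ k - a $ k)}"

definition satisfies :: "real ^ 'n \<Rightarrow> real ^ 'd ^ 'n \<Rightarrow> bool ^ 'd ^ 'n::finite \<Rightarrow> bool" where
  "satisfies x M S \<longleftrightarrow> (\<forall>i j. S $ i $ j \<longrightarrow> x \<in> Dom i (column j M))"

definition satisfiable :: "real ^ 'd ^ 'n \<Rightarrow> bool ^ 'd ^ 'n::finite \<Rightarrow> bool" where
  "satisfiable M S \<longleftrightarrow> (\<exists>x. satisfies x M S)"

text \<open>The partial bijection \<open>\<sigma> : J \<rightarrow> I\<close> is encoded as a partial map, so that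
  \<open>J = dom \<sigma>\<close> and \<open>I = ran \<sigma>\<close>.\<close>

definition partial_bijection :: "('d \<rightharpoonup> 'n) \<Rightarrow> bool" where
  "partial_bijection \<sigma> \<longleftrightarrow> bij_betw (\<lambda>j. the (\<sigma> j)) (dom \<sigma>) (ran \<sigma>)"

definition bool_matrix :: "('d \<rightharpoonup> 'n) \<Rightarrow> bool ^ 'd ^ 'n" where
  "bool_matrix \<sigma> = (\<chi> i j. j \<in> dom \<sigma> \<and> i = the (\<sigma> j))"

text \<open>The order on \<^typ>\<open>bool ^ 'd ^ 'n\<close> is the library's componentwise order
  with \<open>False \<le> True\<close>.\<close>

definition contains :: "bool ^ 'd ^ 'n \<Rightarrow> ('d \<rightharpoonup> 'n) \<Rightarrow> bool" where
  "contains S \<sigma> \<longleftrightarrow> bool_matrix \<sigma> \<le> S"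

end

theory Submission
  imports Defs
begin

text \<open>A point \<open>x\<close> satisfies \<open>S\<close> iff \<open>x\<^sub>i - x\<^sub>k \<le> M\<^sub>i\<^sub>j - M\<^sub>k\<^sub>j\<close> whenever
  \<open>S\<^sub>i\<^sub>j = 1\<close>, a system of difference constraints: it is solvable iff the graph with an edge
  from \<open>i\<close> to \<open>k\<close> of weight \<open>M\<^sub>i\<^sub>j - M\<^sub>k\<^sub>j\<close> for each entry \<open>(i, j)\<close> of \<open>S\<close> has no negative
  cycle, shortest walks providing a solution. If two entries of a cycle lie in the same row or in
  the same column, exchanging their successors splits the cycle into two shorter ones of the same
  total weight. Hence a shortest negative cycle is a partial bijection contained in \<open>S\<close>,
  and summing the constraints of a point satisfying it around the cycle shows that its
  weight is nonnegative.\<close>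

lemma satisfies_iff:
  "satisfies x M S \<longleftrightarrow> (\<forall>i j k. S $ i $ j \<longrightarrow> x $ i - x $ k \<le> M $ i $ j - M $ k $ j)"
proof -
  have "x \<in> Dom i a \<longleftrightarrow> (\<forall>k. x $ i - x $ k \<le> a $ i - a $ k)" for i a
  proof -
    have "x \<in> Dom i a \<longleftrightarrow> (\<forall>k. x $ i - a $ i \<le> x $ k - a $ k)"
      unfolding Dom_def by (auto simp: eq_Min_iff)
    then show ?thesis
      by (simp add: algebra_simps)
  qed
  then show ?thesis
    by (auto simp: satisfies_def column_def)
qed

lemma satisfies_mono: "satisfies x M S \<Longrightarrow> T \<le> S \<Longrightarrow> satisfies x M T"
  unfolding satisfies_iff less_eq_vec_def by (auto simp: le_bool_def)

text \<open>A walk is the list of its entries together with its final row: from \<open>(i, j)\<close> it moves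
  to the row of the next entry, or to the final row.\<close>

fun start :: "('n \<times> 'd) list \<Rightarrow> 'n \<Rightarrow> 'n" where
  "start [] k = k"
| "start (e # l) k = fst e"

fun weight :: "real ^ 'd ^ 'n \<Rightarrow> ('n \<times> 'd) list \<Rightarrow> 'n \<Rightarrow> real" where
  "weight M [] k = 0"
| "weight M (e # l) k = M $ fst e $ snd e - M $ start l k $ snd e + weight M l k"

lemma start_append: "start (l @ l') k = start l (start l' k)"
  by (cases l) auto

lemma weight_append: "weight M (l @ l') k = weight M l (start l' k) + weight M l' k"
  by (induction l) (auto simp: start_append)

text \<open>The constraints of the entries telescope along the walk.\<close>

lemma satisfies_weight_ge:
  assumes "satisfies x M S" "\<forall>(i, j) \<in> set l. S $ i $ j"
  shows "x $ start l k - x $ k \<le> weight M l k"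
  using assms(2)
proof (induction l)
  case Nil
  then show ?case by simp
next
  case (Cons e l)
  have "x $ fst e - x $ start l k \<le> M $ fst e $ snd e - M $ start l k $ snd e"
    using assms(1) Cons.prems by (auto simp: satisfies_iff)
  then show ?case
    using Cons by auto
qed

lemma not_distinct_map_decomp:
  assumes "\<not> distinct (map f l)"
  obtains A e B e' C where "l = A @ e # B @ e' # C" "f e = f e'"
proof -
  obtain as bs cs y where "map f l = as @ y # bs @ y # cs"
    using not_distinct_decomp[OF assms] by auto
  then obtain A L where "l = A @ L" "map f L = y # bs @ y # cs"
    using map_eq_append_conv[THEN iffD1] by metis
  moreover from this(2) obtain e L' where "L = e # L'" "f e = y" "map f L' = bs @ y # cs"
    using map_eq_Cons_D by metis
  moreover from this(3) obtain B K where "L' = B @ K" "map f K = y # cs"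
    using map_eq_append_conv[THEN iffD1] by metis
  moreover from this(2) obtain e' C where "K = e' # C" "f e' = y"
    using map_eq_Cons_D by metis
  ultimately show thesis
    using that by simp
qed

text \<open>For nonempty \<open>l\<close>, \<open>start l undefined\<close> is the first row, and taking it as
  the final row closes the walk up to a cycle.\<close>

lemma cycle_weight_nonneg:
  fixes M :: "real ^ 'd ^ 'n" and S :: "bool ^ 'd ^ 'n"
  assumes sat: "\<And>\<sigma> :: 'd \<rightharpoonup> 'n. partial_bijection \<sigma> \<Longrightarrow> contains S \<sigma> \<Longrightarrow>
      satisfiable M (bool_matrix \<sigma>)"
    and "\<forall>(i, j) \<in> set l. S $ i $ j"
  shows "0 \<le> weight M l (start l undefined)"
  using assms(2)
proof (induction l rule: length_induct)
  case (1 l)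
  have IH: "0 \<le> weight M l' (start l' undefined)" if "length l' < length l" "set l' \<subseteq> set l" for l'
    using 1 that by blast
  consider "distinct (map fst l)" "distinct (map snd l)"
    | "\<not> distinct (map fst l)" | "\<not> distinct (map snd l)" by blast
  then show ?case
  proof cases
    case 1
    \<comment> \<open>Distinct columns make the entries of the cycle a partial map from columns to
      rows, distinct rows make it injective.\<close>
    define \<sigma> where "\<sigma> = map_of (map prod.swap l)"
    have dist: "distinct (map fst (map prod.swap l))"
      using 1 by (simp add: comp_def)
    have \<sigma>: "\<sigma> j = Some i \<longleftrightarrow> (i, j) \<in> set l" for i j
      unfolding \<sigma>_def using map_of_eq_Some_iff[OF dist, of j i] by force
    have "inj_on fst (set l)"
      using 1 by (simp add: distinct_map)
    have "inj_on (\<lambda>j. the (\<sigma> j)) (dom \<sigma>)"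
    proof (rule inj_onI)
      fix j j' assume "j \<in> dom \<sigma>" "j' \<in> dom \<sigma>" "the (\<sigma> j) = the (\<sigma> j')"
      then obtain i where "(i, j) \<in> set l" "(i, j') \<in> set l"
        using \<sigma> by fastforce
      then show "j = j'"
        using inj_onD[OF \<open>inj_on fst (set l)\<close>] by fastforce
    qed
    moreover have "(\<lambda>j. the (\<sigma> j)) ` dom \<sigma> = ran \<sigma>"
      by (force simp: ran_def dom_def)
    ultimately have "partial_bijection \<sigma>"
      unfolding partial_bijection_def bij_betw_def by blast
    moreover have "contains S \<sigma>"
      using "1.prems" by (fastforce simp: contains_def bool_matrix_def less_eq_vec_def dom_def \<sigma>[symmetric])
    ultimately obtain x where x: "satisfies x M (bool_matrix \<sigma>)"
      using sat unfolding satisfiable_def by blast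
    have "\<forall>(i, j) \<in> set l. bool_matrix \<sigma> $ i $ j"
    proof safe
      fix i j assume "(i, j) \<in> set l"
      then have "\<sigma> j = Some i" by (simp add: \<sigma>)
      then show "bool_matrix \<sigma> $ i $ j" by (auto simp: bool_matrix_def)
    qed
    \<comment> \<open>The walk is closed, so the left side of the bound vanishes.\<close>
    from satisfies_weight_ge[OF x this, of "start l undefined"] show ?thesis
      by (cases l) auto
  next
    case 2
    then obtain A e B e' C where l: "l = A @ e # B @ e' # C" "fst e = fst e'"
      by (rule not_distinct_map_decomp)
    \<comment> \<open>The cycle visits the row of \<open>e\<close> twice and is cut there into two
      cycles.\<close>
    have "0 \<le> weight M (A @ e' # C) (start (A @ e' # C) undefined)"
      "0 \<le> weight M (e # B) (start (e # B) undefined)"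
      by (rule IH; use l in auto)+
    then show ?thesis
      using l by (simp add: weight_append start_append)
  next
    case 3
    then obtain A e B e' C where l: "l = A @ e # B @ e' # C" "snd e = snd e'"
      by (rule not_distinct_map_decomp)
    \<comment> \<open>Now \<open>e\<close> moves to the old target of \<open>e'\<close> and vice
      versa. The subtracted terms lie in the common column, so the total weight is
      unchanged.\<close>
    have "0 \<le> weight M (A @ e # C) (start (A @ e # C) undefined)"
      "0 \<le> weight M (B @ [e']) (start (B @ [e']) undefined)"
      by (rule IH; use l in auto)+
    then show ?thesis
      using l by (simp add: weight_append start_append)
  qed
qed

text \<open>Between two occurrences of an entry the walk is a cycle, whose removal does not increase
  the weight. This leaves finitely many walks to minimize over.\<close>

lemma exists_distinct_walk:
  assumes cyc: "\<And>l'. set l' \<subseteq> E \<Longrightarrow> 0 \<le> weight M l' (start l' undefined)"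
    and "set l \<subseteq> E"
  shows "\<exists>l'. set l' \<subseteq> E \<and> distinct l' \<and> start l' k = start l k \<and> weight M l' k \<le> weight M l k"
  using assms(2)
proof (induction l rule: length_induct)
  case (1 l)
  show ?case
  proof (cases "distinct l")
    case True
    then show ?thesis using "1.prems" by blast
  next
    case False
    then obtain A e B C where l: "l = A @ e # B @ e # C"
      using not_distinct_decomp[OF False] by auto
    have "0 \<le> weight M (e # B) (start (e # B) undefined)"
      using l "1.prems" by (intro cyc) auto
    then have "weight M (A @ e # C) k \<le> weight M l k" "start (A @ e # C) k = start l k"
      using l by (auto simp: weight_append start_append)
    moreover have "length (A @ e # C) < length l" "set (A @ e # C) \<subseteq> E"
      using l "1.prems" by auto
    ultimately show ?thesis
      using "1.IH" by (metis order_trans)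
  qed
qed

lemma satisfiable_if_cycle_weights_nonneg:
  fixes M :: "real ^ 'd ^ 'n" and S :: "bool ^ 'd ^ 'n"
  assumes cyc: "\<And>l. \<forall>(i, j) \<in> set l. S $ i $ j \<Longrightarrow> 0 \<le> weight M l (start l undefined)"
  shows "satisfiable M S"
proof -
  define E where "E = {(i, j). S $ i $ j}"
  define P where "P = {l. set l \<subseteq> E \<and> distinct l}"
  \<comment> \<open>The final row \<open>k\<close> is left free: the empty walk then makes every
    \<open>W i\<close> nonempty, whether or not the graph is connected.\<close>
  define W where "W i = (\<lambda>(l, k). weight M l k) ` {(l, k). l \<in> P \<and> start l k = i}" for i
  define x where "x = (\<chi> i. Min (W i))"
  have cycE: "0 \<le> weight M l (start l undefined)" if "set l \<subseteq> E" for l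
    using that by (intro cyc) (auto simp: E_def)
  have "finite P"
    unfolding P_def by (intro finite_subset_distinct) simp
  then have "finite {(l, k). l \<in> P \<and> start l k = i}" for i
    by (rule finite_subset[rotated, OF finite_cartesian_product[OF _ finite]]) auto
  then have fin: "finite (W i)" for i
    by (simp add: W_def)
  have "([], i) \<in> {(l, k). l \<in> P \<and> start l k = i}" for i
    by (simp add: P_def)
  then have ne: "W i \<noteq> {}" for i
    unfolding W_def by blast
  have "x $ i - x $ k \<le> M $ i $ j - M $ k $ j" if ij: "S $ i $ j" for i j k
  proof -
    obtain l k' where l: "l \<in> P" "start l k' = k" "x $ k = weight M l k'"
      using Min_in[OF fin ne, of k] by (auto simp: W_def x_def)
    \<comment> \<open>Prepending \<open>(i, j)\<close> to a shortest walk from \<open>k\<close>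
      gives a walk from \<open>i\<close>, possibly with a repeated entry.\<close>
    have "set ((i, j) # l) \<subseteq> E"
      using l ij by (auto simp: P_def E_def)
    from exists_distinct_walk[OF cycE this, of k']
    obtain l' where l': "l' \<in> P" "start l' k' = i" "weight M l' k' \<le> weight M ((i, j) # l) k'"
      by (auto simp: P_def simp del: weight.simps)
    then have "weight M l' k' \<in> W i"
      by (auto simp: W_def)
    then have "x $ i \<le> weight M l' k'"
      using fin by (simp add: x_def)
    then show ?thesis
      using l l' by simp
  qed
  then show ?thesis
    unfolding satisfiable_def satisfies_iff by blast
qed

theorem theorem4p1:
  fixes M :: "real ^ 'd ^ 'n" and S :: "bool ^ 'd ^ 'n"
  shows "satisfiable M S \<longleftrightarrow>
    (\<forall>\<sigma> :: 'd \<rightharpoonup> 'n. partial_bijection \<sigma> \<and> contains S \<sigma> \<longrightarrow> satisfiable M (bool_matrix \<sigma>))"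
proof
  assume "satisfiable M S"
  then show "\<forall>\<sigma> :: 'd \<rightharpoonup> 'n. partial_bijection \<sigma> \<and> contains S \<sigma> \<longrightarrow> satisfiable M (bool_matrix \<sigma>)"
    unfolding satisfiable_def contains_def using satisfies_mono by blast
next
  assume "\<forall>\<sigma> :: 'd \<rightharpoonup> 'n. partial_bijection \<sigma> \<and> contains S \<sigma> \<longrightarrow> satisfiable M (bool_matrix \<sigma>)"
  then have "0 \<le> weight M l (start l undefined)" if "\<forall>(i, j) \<in> set l. S $ i $ j" for l
    using cycle_weight_nonneg that by blast
  then show "satisfiable M S"
    by (rule satisfiable_if_cycle_weights_nonneg)
qed

end
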